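(* A separable Banach space $X$ is an almost Daugavet space if and only if $X^*$ contains a double-norming asymptotic $\ell_1$-sequence.
   Context: $B_X$, $S_X$ denote the closed unit ball and unit sphere of a Banach space $X$; $\operatorname{lin}$ denotes the linear span (no closure). A linear subspace $Y\subset X^*$ is norming if $\sup_{y^*\in S_Y}|y^*(x)|=\|x\|$ for every $x\in X$. $X$ has the Daugavet property with respect to a subspace $Y\subset X^*$ if $\|\mathrm{Id}+T\|=1+\|T\|$ holds for every operator $T\colon X\to X$ of the form $T=y^*\otimes x$ (i.e. $T(z)=y^*(z)x$) with $x\in X$ and $y^*\in Y$. $X$ is an almost Daugavet space if it has the Daugavet property with respect to some norming subspace $Y\subset X^*$. Let $E$ be a subspace of a Banach space $F$ and $\varepsilon>0$. An element $e\in B_F$ is $(\varepsilon,1)$-orthogonal to $E$ if $\|x+te\|\ge(1-\varepsilon)(\|x\|+|t|)$ for every $x\in E$ and $t\in\mathbb{R}$. Let $E$ be a Banach space. A sequence $\{e_n\}_{n\in\mathbb{N}}\subset B_E\setminus\{0\}$ is an asymptotic $\ell_1$-sequence if there is a sequence of numbers $\varepsilon_n>0$ with $\prod_{n\in\mathbb{N}}(1-\varepsilon_n)>0$ such that $e_{n+1}$ is $(\varepsilon_n,1)$-orthogonal to $\operatorname{lin}\{e_1,\dots,e_n\}$ for every $n\in\mathbb{N}$. A sequence $\{e_n^*\}_{n\in\mathbb{N}}\subset B_{X^*}$ is double-norming if $\operatorname{lin}\{e_k^*\}_{k=n}^\infty$ is a norming subspace of $X^*$ for every $n\in\mathbb{N}$.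 *)

theory Defs
  imports "HOL-Analysis.Analysis"
begin

text \<open>All spaces are real; the dual of \<open>'a\<close> is the normed space \<open>'a \<Rightarrow>\<^sub>L real\<close>.\<close>

text \<open>
  The supremum is bounded above by \<open>norm x\<close>. It is taken over the empty set only for
  \<open>Y = {0}\<close>; it is then an unspecified real not depending on \<open>x\<close>, so \<open>{0}\<close> is not norming
  unless \<open>'a\<close> is the zero space. On the zero space the value is immaterial for
  \<open>almost_Daugavet\<close> and for asymptotic \<open>\<ell>\<^sub>1\<close>-sequences in the dual: it has neither.
\<close>

definition norming :: "('a::real_normed_vector \<Rightarrow>\<^sub>L real) set \<Rightarrow> bool" where
  "norming Y \<longleftrightarrow> subspace Y \<and>
     (\<forall>x. (SUP y \<in> Y \<inter> sphere 0 1. \<bar>blinfun_apply y x\<bar>) = norm x)"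

definition rank_one :: "('a::real_normed_vector \<Rightarrow>\<^sub>L real) \<Rightarrow> 'a \<Rightarrow> 'a \<Rightarrow>\<^sub>L 'a" where
  "rank_one y x = blinfun_scaleR_left x o\<^sub>L y"

lemma rank_one_apply [simp]: "blinfun_apply (rank_one y x) z = blinfun_apply y z *\<^sub>R x"
  by (simp add: rank_one_def)

definition Daugavet_property :: "('a::real_normed_vector \<Rightarrow>\<^sub>L real) set \<Rightarrow> bool" where
  "Daugavet_property Y \<longleftrightarrow>
     (\<forall>x. \<forall>y\<in>Y. norm (id_blinfun + rank_one y x) = 1 + norm (rank_one y x))"

definition almost_Daugavet :: "'a::banach itself \<Rightarrow> bool" where
  "almost_Daugavet (_ :: 'a itself) \<longleftrightarrow>
     (\<exists>Y :: ('a \<Rightarrow>\<^sub>L real) set. norming Y \<and> Daugavet_property Y)"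

definition eps1_orthogonal :: "real \<Rightarrow> 'a::real_normed_vector \<Rightarrow> 'a set \<Rightarrow> bool" where
  "eps1_orthogonal \<epsilon> e E \<longleftrightarrow> e \<in> cball 0 1 \<and>
     (\<forall>x\<in>E. \<forall>t::real. norm (x + t *\<^sub>R e) \<ge> (1 - \<epsilon>) * (norm x + \<bar>t\<bar>))"

text \<open>
  Sequences are indexed from \<open>0\<close>. A nonzero value of \<open>has_prod\<close> means that the partial products
  converge to it and no factor vanishes. As only \<open>\<epsilon> n > 0\<close> is imposed, finitely many
  \<open>\<epsilon> n\<close> (an even number) may exceed \<open>1\<close>.
\<close>

definition asymptotic_l1_seq :: "(nat \<Rightarrow> 'a::banach) \<Rightarrow> bool" where
  "asymptotic_l1_seq e \<longleftrightarrow> (\<forall>n. e n \<in> cball 0 1 - {0}) \<and>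
     (\<exists>\<epsilon>::nat \<Rightarrow> real. (\<forall>n. \<epsilon> n > 0) \<and> (\<exists>p>0. (\<lambda>n. 1 - \<epsilon> n) has_prod p) \<and>
        (\<forall>n. eps1_orthogonal (\<epsilon> n) (e (Suc n)) (span (e ` {..n}))))"

definition double_norming :: "(nat \<Rightarrow> 'a::real_normed_vector \<Rightarrow>\<^sub>L real) \<Rightarrow> bool" where
  "double_norming e \<longleftrightarrow> (\<forall>n. e n \<in> cball 0 1) \<and> (\<forall>n. norming (span (e ` {n..})))"

end

theory Submission
  imports Defs
begin

text \<open>
  Suppose that \<open>Y\<close> witnesses the almost Daugavet property. By duality, for a unit vector \<open>x\<close> and
  finitely many unit functionals \<open>y\<close> in \<open>Y\<close> there is a slice of the dual ball, determined by a unit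
  vector \<open>u\<close>, on which every functional almost norms \<open>x\<close> and is almost \<open>\<ell>\<^sub>1\<close>-orthogonal to every \<open>y\<close>.
  As the slice is again given by a vector, the functionals \<open>y\<close> can be treated one after another, and
  a finite net of the sphere of a finite-dimensional subspace of \<open>Y\<close> yields a functional orthogonal
  to all of it. Choosing such functionals successively, for a dense sequence in which every member
  recurs infinitely often, gives the double-norming sequence.

  Conversely, let \<open>Y\<close> be the span of the sequence. Given \<open>y \<in> Y\<close> and \<open>x\<close>, a functional in a
  sufficiently late tail that almost norms \<open>x\<close> is almost \<open>\<ell>\<^sub>1\<close>-orthogonal to \<open>y\<close>, and a vector almost
  norming the sum of both witnesses the Daugavet equation for \<open>y\<close> and \<open>x\<close>.
\<close>

section \<open>Functionals and norming subspaces\<close>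

lemma blinfun_norm_approx:
  fixes T :: "'a::real_normed_vector \<Rightarrow>\<^sub>L 'b::real_normed_vector"
  assumes "c < norm T"
  obtains z where "norm z \<le> 1" "c < norm (blinfun_apply T z)"
proof -
  have "\<exists>z. norm z \<le> 1 \<and> c < norm (blinfun_apply T z)"
  proof (rule ccontr)
    assume "\<not> ?thesis"
    then have le: "norm (blinfun_apply T z) \<le> c" if "norm z \<le> 1" for z
      using that by force
    have "0 \<le> c"
      using le[of 0] by simp
    moreover have "norm (blinfun_apply T z) \<le> c * norm z" for z
    proof (cases "z = 0")
      case False
      then have "norm (blinfun_apply T (z /\<^sub>R norm z)) \<le> c"
        by (intro le) simp
      then show ?thesis
        using False by (simp add: blinfun.scaleR_right field_simps)
    qed simp
    ultimately have "norm T \<le> c"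
      by (rule norm_blinfun_bound)
    then show False
      using assms by simp
  qed
  then show ?thesis
    using that by blast
qed

lemma blinfun_abs_le:
  fixes f :: "'a::real_normed_vector \<Rightarrow>\<^sub>L real"
  assumes "norm f \<le> 1"
  shows "\<bar>blinfun_apply f x\<bar> \<le> norm x"
  using norm_blinfun[of f x] mult_right_mono[OF assms norm_ge_zero[of x]] by simp

lemma blinfun_real_norm_approx:
  fixes f :: "'a::real_normed_vector \<Rightarrow>\<^sub>L real"
  assumes "c < norm f"
  obtains z where "norm z \<le> 1" "c < blinfun_apply f z"
proof -
  obtain z where z: "norm z \<le> 1" "c < norm (blinfun_apply f z)"
    using blinfun_norm_approx[OF assms] .
  then show ?thesis
    using that[of z] that[of "- z"]
    by (cases "0 \<le> blinfun_apply f z") (auto simp: blinfun.minus_right)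
qed

text \<open>The nonzero vector \<open>x0\<close> forces \<open>Y\<close> to contain unit
  functionals: a supremum over the empty set would have the same value at \<open>x0\<close> and at
  \<open>0\<close>. The absolute value disappears because \<open>Y\<close> is closed under
  negation.\<close>

lemma norming_approx:
  assumes Y: "norming Y" and "x0 \<noteq> (0::'a::real_normed_vector)" and "0 < \<delta>"
  obtains y where "y \<in> Y" "norm y = 1" "norm (x::'a) - \<delta> < blinfun_apply y x"
proof -
  let ?S = "Y \<inter> sphere 0 1"
  have sup: "(SUP y \<in> ?S. \<bar>blinfun_apply y z\<bar>) = norm z" for z
    using Y by (simp add: norming_def)
  have "?S \<noteq> {}"
  proof
    assume "?S = {}"
    then have "norm x0 = norm (0::'a)"
      using sup[of x0] sup[of 0] by simp
    then show False
      using assms(2) by simp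
  qed
  moreover have "bdd_above ((\<lambda>y. \<bar>blinfun_apply y x\<bar>) ` ?S)"
    by (intro bdd_aboveI[of _ "norm x"]) (auto intro: blinfun_abs_le)
  ultimately have "norm x - \<delta> < (SUP y \<in> ?S. \<bar>blinfun_apply y x\<bar>) \<longleftrightarrow>
      (\<exists>y\<in>?S. norm x - \<delta> < \<bar>blinfun_apply y x\<bar>)"
    by (rule less_cSUP_iff)
  then obtain y where y: "y \<in> ?S" "norm x - \<delta> < \<bar>blinfun_apply y x\<bar>"
    unfolding sup using assms(3) by auto
  have "- y \<in> Y"
    using Y y by (simp add: norming_def subspace_neg)
  then show ?thesis
    using y that[of y] that[of "- y"]
    by (cases "0 \<le> blinfun_apply y x") (auto simp: blinfun.minus_left)
qed

lemma normingI:
  fixes Y :: "('a::real_normed_vector \<Rightarrow>\<^sub>L real) set"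
  assumes "subspace Y"
    and approx: "\<And>x \<delta>. 0 < \<delta> \<Longrightarrow> \<exists>y\<in>Y. norm y = 1 \<and> norm x - \<delta> \<le> blinfun_apply y x"
  shows "norming Y"
  unfolding norming_def
proof (intro conjI allI)
  fix x :: 'a
  show "(SUP y \<in> Y \<inter> sphere 0 1. \<bar>blinfun_apply y x\<bar>) = norm x"
  proof (rule cSup_eq_non_empty)
    show "(\<lambda>y. \<bar>blinfun_apply y x\<bar>) ` (Y \<inter> sphere 0 1) \<noteq> {}"
      using approx[of 1 x] by auto
    show "r \<le> norm x" if "r \<in> (\<lambda>y. \<bar>blinfun_apply y x\<bar>) ` (Y \<inter> sphere 0 1)" for r
      using that by (auto intro: blinfun_abs_le)
    fix b
    assume b: "\<And>r. r \<in> (\<lambda>y. \<bar>blinfun_apply y x\<bar>) ` (Y \<inter> sphere 0 1) \<Longrightarrow> r \<le> b"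
    show "norm x \<le> b"
    proof (rule field_le_epsilon)
      fix \<delta> :: real
      assume "0 < \<delta>"
      then obtain y where "y \<in> Y" "norm y = 1" "norm x - \<delta> \<le> blinfun_apply y x"
        using approx by blast
      then show "norm x \<le> b + \<delta>"
        using b[of "\<bar>blinfun_apply y x\<bar>"] by auto
    qed
  qed
qed (fact assms(1))

lemma norm_rank_one [simp]: "norm (rank_one y x) = norm y * norm x"
proof (rule antisym)
  show "norm (rank_one y x) \<le> norm y * norm x"
  proof (rule norm_blinfun_bound)
    show "norm (blinfun_apply (rank_one y x) z) \<le> norm y * norm x * norm z" for z
      using mult_right_mono[OF norm_blinfun[of y z] norm_ge_zero[of x]]
      by (simp add: mult_ac)
  qed simp
  show "norm y * norm x \<le> norm (rank_one y x)"
  proof (cases "x = 0")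
    case False
    have "norm y \<le> norm (rank_one y x) / norm x"
    proof (rule norm_blinfun_bound)
      show "norm (blinfun_apply y z) \<le> norm (rank_one y x) / norm x * norm z" for z
        using norm_blinfun[of "rank_one y x" z] False by (simp add: field_simps)
    qed simp
    then show ?thesis
      using False by (simp add: field_simps)
  qed simp
qed

section \<open>Almost orthogonal functionals\<close>

text \<open>If \<open>z\<close> almost attains the norm 2 of Id + \<open>rank_one y x\<close>, the
  image of \<open>z\<close>, normalised, determines the slice. For \<open>f\<close> in it,
  \<open>f z + y z * f x\<close> is almost 2. Neither summand exceeds 1, so \<open>f z\<close>,
  \<open>y z\<close> and \<open>f x\<close> are all close to 1, and \<open>z\<close> witnesses that
  \<open>y + f\<close> has norm almost 2.\<close>

lemma Daugavet_slice:
  fixes x :: "'a::real_normed_vector"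
  assumes D: "Daugavet_property Y" and "y \<in> Y" "norm y = 1" "norm x = 1" "0 < \<epsilon>"
  obtains u \<delta> where "norm u = 1" "0 < \<delta>"
    "\<And>f. norm f \<le> 1 \<Longrightarrow> 1 - \<delta> < blinfun_apply f u \<Longrightarrow> 1 - \<epsilon> < blinfun_apply f x \<and> 2 - \<epsilon> < norm (y + f)"
proof -
  \<comment> \<open>The value of \<open>y + f\<close> at \<open>z\<close> loses
    \<open>\<eta>\<close> twice, hence the half. The bound 1 makes the product
    \<open>y z * f x\<close> positive below, which fixes the sign of \<open>f x\<close>.\<close>
  define \<eta> where "\<eta> = min 1 (\<epsilon> / 2)"
  have \<eta>: "0 < \<eta>" "\<eta> \<le> 1" "2 * \<eta> \<le> \<epsilon>"
    using assms(5) by (auto simp: \<eta>_def)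
  have "norm (id_blinfun + rank_one y x) = 2"
    using assms by (simp add: Daugavet_property_def)
  then have "2 - \<eta> < norm (id_blinfun + rank_one y x)"
    using \<eta> by simp
  then obtain z0 where z0: "norm z0 \<le> 1" "2 - \<eta> < norm (blinfun_apply (id_blinfun + rank_one y x) z0)"
    by (rule blinfun_norm_approx)
  \<comment> \<open>Changing the sign of \<open>z0\<close> makes \<open>y z\<close> nonnegative and
    preserves the norm of the image.\<close>
  define z where "z = (if 0 \<le> blinfun_apply y z0 then z0 else - z0)"
  have "z = z0 \<or> z = - z0" "0 \<le> blinfun_apply y z"
    by (auto simp: z_def blinfun.minus_right)
  moreover define v where "v = z + blinfun_apply y z *\<^sub>R x"
  moreover have "norm (- z0 - blinfun_apply y z0 *\<^sub>R x) = norm (z0 + blinfun_apply y z0 *\<^sub>R x)"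
    by (metis add_uminus_conv_diff minus_add_distrib norm_minus_cancel)
  ultimately have z: "norm z \<le> 1" "0 \<le> blinfun_apply y z" and v: "2 - \<eta> < norm v"
    using z0 by (auto simp: blinfun.add_left blinfun.minus_right)
  have v0: "0 < norm v"
    using v \<eta> by linarith
  \<comment> \<open>With this value the slice condition at \<open>v /\<^sub>R norm v\<close> says
    exactly that \<open>f v\<close> exceeds \<open>2 - \<eta>\<close>.\<close>
  define \<delta> where "\<delta> = 1 - (2 - \<eta>) / norm v"
  have "0 < \<delta>"
    using v v0 by (simp add: \<delta>_def field_simps)
  moreover have "norm (v /\<^sub>R norm v) = 1"
    using v0 by simp
  moreover have "1 - \<epsilon> < blinfun_apply f x \<and> 2 - \<epsilon> < norm (y + f)"
    if f: "norm f \<le> 1" "1 - \<delta> < blinfun_apply f (v /\<^sub>R norm v)" for f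
  proof -
    have "(2 - \<eta>) / norm v < blinfun_apply f v / norm v"
      using f(2) by (simp add: \<delta>_def blinfun.scaleR_right divide_inverse_commute)
    then have "2 - \<eta> < blinfun_apply f v"
      using v0 by (simp only: divide_less_cancel)
    then have sum: "2 - \<eta> < blinfun_apply f z + blinfun_apply y z * blinfun_apply f x"
      by (simp add: v_def blinfun.add_right blinfun.scaleR_right)
    have fz: "blinfun_apply f z \<le> 1" and fx: "blinfun_apply f x \<le> 1" and yz: "blinfun_apply y z \<le> 1"
      using blinfun_abs_le[OF f(1), of z] blinfun_abs_le[OF f(1), of x] blinfun_abs_le[of y z] assms z
      by auto
    have "blinfun_apply y z * blinfun_apply f x \<le> blinfun_apply y z"
      using mult_left_mono[OF fx z(2)] by simp
    with sum fz have y1: "1 - \<eta> < blinfun_apply y z" and f1: "1 - \<eta> < blinfun_apply f z"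
      using yz by auto
    have prod: "1 - \<eta> < blinfun_apply y z * blinfun_apply f x"
      using sum fz by linarith
    then have "0 < blinfun_apply y z * blinfun_apply f x"
      using \<eta> by linarith
    then have "0 < blinfun_apply f x"
      using z(2) by (auto simp: zero_less_mult_iff)
    then have "blinfun_apply y z * blinfun_apply f x \<le> blinfun_apply f x"
      using mult_right_mono[OF yz, of "blinfun_apply f x"] by simp
    then have "1 - \<epsilon> < blinfun_apply f x"
      using prod \<eta> by linarith
    moreover have "blinfun_apply (y + f) z \<le> norm (y + f)"
      using norm_blinfun[of "y + f" z] mult_left_mono[OF z(1) norm_ge_zero[of "y + f"]] by simp
    then have "2 - \<epsilon> < norm (y + f)"
      using y1 f1 \<eta> by (simp add: blinfun.add_left)
    ultimately show ?thesis ..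
  qed
  ultimately show ?thesis
    using that by blast
qed

text \<open>Induction on \<open>F\<close>: \<open>Daugavet_slice\<close> is applied to the new
  functional and to the vector \<open>u\<close> of the previous slice instead of \<open>x\<close>.
  Accuracy \<open>min \<delta> \<epsilon>\<close> places the new slice inside the old one.\<close>

lemma Daugavet_slice_finite:
  fixes x :: "'a::real_normed_vector"
  assumes D: "Daugavet_property Y" and "finite F" "F \<subseteq> Y \<inter> sphere 0 1" "norm x = 1" "0 < \<epsilon>"
  shows "\<exists>u \<delta>. norm u = 1 \<and> 0 < \<delta> \<and> (\<forall>f. norm f \<le> 1 \<longrightarrow> 1 - \<delta> < blinfun_apply f u \<longrightarrow>
      1 - \<epsilon> < blinfun_apply f x \<and> (\<forall>y\<in>F. 2 - \<epsilon> < norm (y + f)))"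
  using assms(2,3)
proof (induction F)
  case empty
  then show ?case
    using assms by auto
next
  case (insert y F)
  then obtain u \<delta> where u: "norm u = 1" "0 < \<delta>" and
    slice: "\<And>f. norm f \<le> 1 \<Longrightarrow> 1 - \<delta> < blinfun_apply f u \<Longrightarrow>
      1 - \<epsilon> < blinfun_apply f x \<and> (\<forall>y\<in>F. 2 - \<epsilon> < norm (y + f))"
    by auto
  have "y \<in> Y" "norm y = 1" "0 < min \<delta> \<epsilon>"
    using insert u assms by auto
  with D u(1) obtain u' \<delta>' where "norm u' = 1" "0 < \<delta>'"
    "\<And>f. norm f \<le> 1 \<Longrightarrow> 1 - \<delta>' < blinfun_apply f u' \<Longrightarrow>
      1 - min \<delta> \<epsilon> < blinfun_apply f u \<and> 2 - min \<delta> \<epsilon> < norm (y + f)"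
    using Daugavet_slice by metis
  then show ?case
    using slice by (intro exI[of _ u'] exI[of _ \<delta>']) fastforce
qed

text \<open>Take the larger coefficient as a common factor of \<open>x + e\<close> and remove the
  excess by the triangle inequality. For \<open>t \<le> a\<close> this gives at least a(2 -
  \<epsilon>) - (a - t), and the other case is symmetric.\<close>

lemma norm_add_scaled_ge:
  fixes x e :: "'a::real_normed_vector"
  assumes "norm x = 1" "norm e \<le> 1" "2 - \<epsilon> \<le> norm (x + e)" "0 \<le> \<epsilon>" "0 \<le> a" "0 \<le> t"
  shows "(1 - \<epsilon>) * (a + t) \<le> norm (a *\<^sub>R x + t *\<^sub>R e)"
proof (cases "t \<le> a")
  case True
  have "a *\<^sub>R (x + e) = (a *\<^sub>R x + t *\<^sub>R e) + (a - t) *\<^sub>R e"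
    by (simp add: algebra_simps)
  then have "a * norm (x + e) \<le> norm (a *\<^sub>R x + t *\<^sub>R e) + (a - t) * norm e"
    using norm_triangle_ineq[of "a *\<^sub>R x + t *\<^sub>R e" "(a - t) *\<^sub>R e"] True assms(5)
    by (metis abs_of_nonneg diff_ge_0_iff_ge norm_scaleR)
  moreover have "a * (2 - \<epsilon>) \<le> a * norm (x + e)" "(a - t) * norm e \<le> a - t"
    using assms True mult_left_mono[of "norm e" 1 "a - t"] by (auto intro: mult_left_mono)
  moreover have "0 \<le> \<epsilon> * t"
    using assms by simp
  ultimately show ?thesis
    by (simp add: algebra_simps)
next
  case False
  have "t *\<^sub>R (x + e) = (a *\<^sub>R x + t *\<^sub>R e) + (t - a) *\<^sub>R x"
    by (simp add: algebra_simps)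
  then have "norm (t *\<^sub>R (x + e)) \<le> norm (a *\<^sub>R x + t *\<^sub>R e) + norm ((t - a) *\<^sub>R x)"
    using norm_triangle_ineq by metis
  then have "t * norm (x + e) \<le> norm (a *\<^sub>R x + t *\<^sub>R e) + (t - a)"
    using False assms by simp
  moreover have "t * (2 - \<epsilon>) \<le> t * norm (x + e)"
    using assms by (intro mult_left_mono)
  moreover have "0 \<le> \<epsilon> * a"
    using assms by simp
  ultimately show ?thesis
    by (simp add: algebra_simps)
qed

text \<open>Scaling reduces \<open>t \<ge> 0\<close> to \<open>norm_add_scaled_ge\<close>. Negative
  \<open>t\<close> follows by passing to \<open>- x\<close>, which again lies in
  \<open>E\<close>.\<close>

lemma eps1_orthogonalI:
  assumes "subspace E" "norm e = 1" "0 \<le> \<epsilon>"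
    and sphere: "\<And>y. y \<in> E \<Longrightarrow> norm y = 1 \<Longrightarrow> 2 - \<epsilon> \<le> norm (y + e)"
  shows "eps1_orthogonal \<epsilon> e E"
  unfolding eps1_orthogonal_def
proof (intro conjI ballI allI)
  show "e \<in> cball 0 1"
    using assms by simp
  have nonneg: "(1 - \<epsilon>) * (norm x + t) \<le> norm (x + t *\<^sub>R e)" if "x \<in> E" "0 \<le> t" for x t
  proof (cases "x = 0")
    case True
    then show ?thesis
      using assms that by (simp add: mult_left_le_one_le algebra_simps)
  next
    case False
    define y where "y = x /\<^sub>R norm x"
    have "y \<in> E" "norm y = 1"
      using False that assms by (auto simp: y_def subspace_scale)
    then have "(1 - \<epsilon>) * (norm x + t) \<le> norm (norm x *\<^sub>R y + t *\<^sub>R e)"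
      using assms that by (intro norm_add_scaled_ge sphere) auto
    then show ?thesis
      using False by (simp add: y_def)
  qed
  fix x t
  assume x: "x \<in> E"
  show "(1 - \<epsilon>) * (norm x + \<bar>t\<bar>) \<le> norm (x + t *\<^sub>R e)"
  proof (cases "0 \<le> t")
    case True
    then show ?thesis
      using nonneg[OF x] by simp
  next
    case False
    have "norm (- x + (- t) *\<^sub>R e) = norm (x + t *\<^sub>R e)"
      by (metis minus_add_distrib norm_minus_cancel scaleR_minus_left)
    then show ?thesis
      using nonneg[of "- x" "- t"] False x assms(1) by (simp add: subspace_neg)
  qed
qed

text \<open>The slice belonging to a finite net of the sphere of \<open>E\<close> contains a unit
  functional of \<open>Y\<close>, because \<open>Y\<close> is norming. Slice and net each contribute
  an error of \<open>\<epsilon> / 2\<close>.\<close>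

lemma Daugavet_orthogonal:
  fixes x :: "'a::real_normed_vector"
  assumes Y: "norming Y" and D: "Daugavet_property Y"
    and E: "subspace E" "E \<subseteq> Y" "compact (E \<inter> sphere 0 1)"
    and x: "norm x = 1" and \<epsilon>: "0 < \<epsilon>"
  obtains f where "f \<in> Y" "norm f = 1" "1 - \<epsilon> < blinfun_apply f x" "eps1_orthogonal \<epsilon> f E"
proof -
  have "E \<inter> sphere 0 1 \<subseteq> (\<Union>y \<in> E \<inter> sphere 0 1. ball y (\<epsilon> / 2))"
    using \<epsilon> by force
  with E(3) obtain F where F: "F \<subseteq> E \<inter> sphere 0 1" "finite F"
    "E \<inter> sphere 0 1 \<subseteq> (\<Union>y\<in>F. ball y (\<epsilon> / 2))"
    using compactE_image[of "E \<inter> sphere 0 1" "E \<inter> sphere 0 1" "\<lambda>y. ball y (\<epsilon> / 2)"] by blast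
  have "F \<subseteq> Y \<inter> sphere 0 1" "0 < \<epsilon> / 2"
    using F E \<epsilon> by auto
  with D F(2) x obtain u \<delta> where u: "norm u = 1" "0 < \<delta>" and
    slice: "\<And>f. norm f \<le> 1 \<Longrightarrow> 1 - \<delta> < blinfun_apply f u \<Longrightarrow>
      1 - \<epsilon> / 2 < blinfun_apply f x \<and> (\<forall>y\<in>F. 2 - \<epsilon> / 2 < norm (y + f))"
    using Daugavet_slice_finite by metis
  have "u \<noteq> 0"
    using u by auto
  with Y u(2) obtain f where f: "f \<in> Y" "norm f = 1" "norm u - \<delta> < blinfun_apply f u"
    using norming_approx by metis
  have f': "1 - \<epsilon> / 2 < blinfun_apply f x" "\<forall>y\<in>F. 2 - \<epsilon> / 2 < norm (y + f)"
    using slice[of f] f u by auto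
  have "eps1_orthogonal \<epsilon> f E"
  proof (rule eps1_orthogonalI)
    fix y
    assume "y \<in> E" "norm y = 1"
    then obtain w where "w \<in> F" "norm (w - y) < \<epsilon> / 2"
      using F(3) by (auto simp: dist_norm)
    moreover have "norm (w + f) \<le> norm (y + f) + norm (w - y)"
      using norm_triangle_ineq[of "y + f" "w - y"] by (simp add: add.commute)
    ultimately show "2 - \<epsilon> \<le> norm (y + f)"
      using f'(2) by force
  qed (use E f \<epsilon> in auto)
  then show ?thesis
    using that f f' \<epsilon> by auto
qed

section \<open>Compactness in finite stages and construction of the orthogonal sequence\<close>

text \<open>Orthogonality bounds both components of a vector of norm at most \<open>R\<close> by
  \<open>R / (1 - \<epsilon>)\<close>. The ball is therefore a closed part of the sum of a compact
  ball in \<open>span A\<close> and a compact segment along \<open>e\<close>. This provides the nets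
  for \<open>Daugavet_orthogonal\<close>.\<close>

lemma compact_span_insert:
  fixes e :: "'a::real_normed_vector"
  assumes A: "\<And>R. compact (span A \<inter> cball 0 R)"
    and e: "eps1_orthogonal \<epsilon> e (span A)" "\<epsilon> < 1"
  shows "compact (span (insert e A) \<inter> cball 0 R)"
proof -
  define R' where "R' = R / (1 - \<epsilon>)"
  define S where "S = span A \<inter> cball 0 R'"
  define T where "T = (\<lambda>t. t *\<^sub>R e) ` {-R'..R'}"
  define K where "K = {x + y | x y. x \<in> S \<and> y \<in> T}"
  have "compact T"
    unfolding T_def by (intro compact_continuous_image continuous_intros) simp
  then have "compact K"
    unfolding K_def using A by (intro compact_sums) (auto simp: S_def)
  moreover have "span (insert e A) \<inter> cball 0 R = K \<inter> cball 0 R"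
  proof (intro equalityI subsetI)
    fix v
    assume v: "v \<in> span (insert e A) \<inter> cball 0 R"
    then obtain t where t: "v - t *\<^sub>R e \<in> span A"
      by (auto simp: span_breakdown_eq)
    then have "(1 - \<epsilon>) * (norm (v - t *\<^sub>R e) + \<bar>t\<bar>) \<le> norm (v - t *\<^sub>R e + t *\<^sub>R e)"
      using e(1) unfolding eps1_orthogonal_def by blast
    then have "norm (v - t *\<^sub>R e) + \<bar>t\<bar> \<le> R'"
      using v e(2) by (simp add: R'_def field_simps)
    then have "norm (v - t *\<^sub>R e) \<le> R'" "t \<in> {-R'..R'}"
      using norm_ge_zero[of "v - t *\<^sub>R e"] unfolding atLeastAtMost_iff by linarith+
    then have "v - t *\<^sub>R e \<in> S" "t *\<^sub>R e \<in> T"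
      using t unfolding S_def T_def by auto
    moreover have "v = (v - t *\<^sub>R e) + t *\<^sub>R e"
      by simp
    ultimately show "v \<in> K \<inter> cball 0 R"
      using v unfolding K_def by blast
  next
    fix v
    assume "v \<in> K \<inter> cball 0 R"
    then obtain x t where v: "v = x + t *\<^sub>R e" "x \<in> span A" "norm v \<le> R"
      by (auto simp: K_def S_def T_def)
    then have "v - t *\<^sub>R e \<in> span A"
      by simp
    then show "v \<in> span (insert e A) \<inter> cball 0 R"
      using v(3) by (auto simp: span_breakdown_eq)
  qed
  ultimately show ?thesis
    using compact_Int_closed by fastforce
qed

lemma compact_span_orthogonal:
  fixes e :: "nat \<Rightarrow> 'a::real_normed_vector"
  assumes "\<And>k. k < n \<Longrightarrow> eps1_orthogonal (\<epsilon> k) (e k) (span (e ` {..<k}))"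
    and "\<And>k. k < n \<Longrightarrow> \<epsilon> k < 1"
  shows "compact (span (e ` {..<n}) \<inter> cball 0 R)"
  using assms
proof (induction n arbitrary: R)
  case 0
  have "{0} \<inter> cball 0 R = {} \<or> {0::'a} \<inter> cball 0 R = {0}"
    by auto
  then show ?case
    by auto
next
  case (Suc n)
  then show ?case
    by (auto simp: lessThan_Suc intro!: compact_span_insert[where \<epsilon> = "\<epsilon> n"])
qed

lemma Daugavet_orthogonal_sequence:
  fixes x :: "nat \<Rightarrow> 'a::real_normed_vector"
  assumes Y: "norming Y" and D: "Daugavet_property Y" and x0: "x0 \<noteq> (0::'a)"
    and \<epsilon>: "\<And>n. 0 < \<epsilon> n" "\<And>n. \<epsilon> n < 1"
  obtains e where "\<And>n. e n \<in> Y" "\<And>n. norm (e n) = 1"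
    "\<And>n. (1 - \<epsilon> n) * norm (x n) \<le> blinfun_apply (e n) (x n)"
    "\<And>n. eps1_orthogonal (\<epsilon> n) (e n) (span (e ` {..<n}))"
proof -
  define P where "P e n f \<longleftrightarrow> f \<in> Y \<and> norm f = 1 \<and>
    (1 - \<epsilon> n) * norm (x n) \<le> blinfun_apply f (x n) \<and> eps1_orthogonal (\<epsilon> n) f (span (e ` {..<n}))"
    for e n f
  have "\<exists>e. \<forall>n. P e n (e n)"
  \<comment> \<open>Recursive choice is possible because \<open>P e n\<close> depends on
    \<open>e\<close> only through its values below \<open>n\<close>.\<close>
  proof (rule dependent_wellorder_choice)
    fix f n and e e' :: "nat \<Rightarrow> 'a \<Rightarrow>\<^sub>L real"
    assume "\<And>k. k < n \<Longrightarrow> e k = e' k"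
    then have "e ` {..<n} = e' ` {..<n}"
      by auto
    then show "P e n f = P e' n f"
      by (simp add: P_def)
  next
    fix n e
    assume IH: "\<And>k. k < n \<Longrightarrow> P e k (e k)"
    let ?E = "span (e ` {..<n})"
    \<comment> \<open>A zero \<open>x n\<close> cannot be normalised, so \<open>x0\<close> takes its
      place. The required estimate then reads 0 \<le> 0.\<close>
    define u where "u = (if x n = 0 then x0 else x n)"
    define v where "v = u /\<^sub>R norm u"
    have u: "u \<noteq> 0"
      using x0 by (simp add: u_def)
    then have v: "norm v = 1"
      by (simp add: v_def)
    have "compact (?E \<inter> cball 0 1)"
      using IH \<epsilon> by (intro compact_span_orthogonal[where \<epsilon> = \<epsilon>]) (auto simp: P_def)
    then have "compact ((?E \<inter> cball 0 1) - ball 0 1)"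
      by (rule compact_diff) simp
    moreover have "(?E \<inter> cball 0 1) - ball 0 1 = ?E \<inter> sphere 0 1"
      by auto
    ultimately have cpt: "compact (?E \<inter> sphere 0 1)"
      by simp
    have sub: "?E \<subseteq> Y"
      using Y IH by (intro span_minimal) (auto simp: norming_def P_def)
    obtain f where f: "f \<in> Y" "norm f = 1" "1 - \<epsilon> n < blinfun_apply f v" "eps1_orthogonal (\<epsilon> n) f ?E"
      using Daugavet_orthogonal[OF Y D subspace_span sub cpt v \<epsilon>(1)] .
    have "(1 - \<epsilon> n) * norm (x n) \<le> blinfun_apply f (x n)"
      using f(3) u by (auto simp: v_def u_def blinfun.scaleR_right field_simps split: if_splits)
    with f show "\<exists>f. P e n f"
      by (auto simp: P_def)
  qed
  then show ?thesis
    using that by (auto simp: P_def)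
qed

text \<open>Absolute summability gives convergence, and positive factors give a positive product.
  The double successor matches the shifted sequence \<open>\<epsilon> (Suc n)\<close> of the
  construction below.\<close>

lemma has_prod_minus_powers_half:
  "\<exists>p>0. (\<lambda>n. 1 - (1 / 2) ^ Suc (Suc n) :: real) has_prod p"
proof -
  have lt: "(1 / 2 :: real) ^ Suc (Suc n) < 1" for n
    by (rule power_Suc_less_one) auto
  have "summable (\<lambda>n. \<bar>- ((1 / 2 :: real) ^ Suc (Suc n))\<bar>)"
    by (simp add: summable_geometric)
  then have "convergent_prod (\<lambda>n. 1 + - ((1 / 2 :: real) ^ Suc (Suc n)))"
    by (rule summable_imp_convergent_prod_real) (metis lt neg_equal_iff_equal less_irrefl)
  then obtain p where p: "(\<lambda>n. 1 - (1 / 2 :: real) ^ Suc (Suc n)) has_prod p"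
    by (auto simp: convergent_prod_has_prod_iff)
  have pos: "0 < 1 - (1 / 2 :: real) ^ Suc (Suc n)" for n
    using lt[of n] by linarith
  then show ?thesis
    using p has_prod_pos[OF p] by blast
qed

text \<open>Indices are decoded as pairs: the first component selects a member of a countable dense
  set, the second is a counter that makes each member recur at arbitrarily late indices.\<close>

lemma separable_recurring_sequence:
  assumes "separable_space (euclidean :: 'a::metric_space topology)"
  obtains x :: "nat \<Rightarrow> 'a::metric_space" where "\<And>z \<delta> n. 0 < \<delta> \<Longrightarrow> \<exists>m\<ge>n. dist (x m) z < \<delta>"
proof -
  obtain C :: "'a set" where C: "countable C" "closure C = UNIV"
    using assms by (auto simp: separable_space_def)
  then have "C \<noteq> {}"
    by auto
  define x where "x n = from_nat_into C (fst (prod_decode n))" for n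
  have "\<exists>m\<ge>n. dist (x m) z < \<delta>" if "0 < \<delta>" for z \<delta> n
  proof -
    obtain c where "c \<in> C" "dist c z < \<delta>"
      using C(2) \<open>0 < \<delta>\<close> closure_approachable[of z C] by auto
    moreover obtain k where "from_nat_into C k = c"
      using \<open>c \<in> C\<close> C(1) from_nat_into_surj by metis
    ultimately have "dist (x (prod_encode (k, n))) z < \<delta>"
      by (simp add: x_def)
    then show ?thesis
      using le_prod_encode_2 by blast
  qed
  then show ?thesis
    using that by blast
qed

section \<open>From the almost Daugavet property to the sequence\<close>

lemma almost_Daugavet_imp_sequence:
  assumes sep: "separable_space (euclidean :: 'a::banach topology)"
    and "almost_Daugavet TYPE('a)"
  shows "\<exists>e :: nat \<Rightarrow> 'a \<Rightarrow>\<^sub>L real. double_norming e \<and> asymptotic_l1_seq e"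
proof -
  obtain Y :: "('a \<Rightarrow>\<^sub>L real) set" where Y: "norming Y" and D: "Daugavet_property Y"
    using assms(2) by (auto simp: almost_Daugavet_def)
  \<comment> \<open>The Daugavet equation for the zero operator says that the identity has norm 1,
    so the space is nonzero.\<close>
  have "norm (id_blinfun + rank_one 0 (0::'a)) = 1 + norm (rank_one 0 (0::'a))"
    using D subspace_0 Y unfolding Daugavet_property_def norming_def by blast
  moreover have "rank_one 0 (0::'a) = 0"
    by (rule blinfun_eqI) simp
  ultimately have "norm (id_blinfun :: 'a \<Rightarrow>\<^sub>L 'a) = 1"
    by simp
  then have "(id_blinfun :: 'a \<Rightarrow>\<^sub>L 'a) \<noteq> 0"
    by auto
  then obtain x0 :: 'a where x0: "x0 \<noteq> 0"
    by (metis blinfun_eqI id_blinfun.rep_eq zero_blinfun.rep_eq)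
  obtain x :: "nat \<Rightarrow> 'a" where x: "\<And>z \<delta> n. 0 < \<delta> \<Longrightarrow> \<exists>m\<ge>n. dist (x m) z < \<delta>"
    using separable_recurring_sequence[OF sep] by blast
  define \<epsilon> :: "nat \<Rightarrow> real" where "\<epsilon> n = (1 / 2) ^ Suc n" for n
  have \<epsilon>: "0 < \<epsilon> n" "\<epsilon> n < 1" for n
    unfolding \<epsilon>_def by (simp, rule power_Suc_less_one) auto
  obtain e where e: "\<And>n. e n \<in> Y" "\<And>n. norm (e n) = 1"
    "\<And>n. (1 - \<epsilon> n) * norm (x n) \<le> blinfun_apply (e n) (x n)"
    "\<And>n. eps1_orthogonal (\<epsilon> n) (e n) (span (e ` {..<n}))"
    using Daugavet_orthogonal_sequence[where \<epsilon> = \<epsilon> and x = x, OF Y D x0 \<epsilon>] by blast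
  have "norming (span (e ` {n..}))" for n
  proof (rule normingI)
    fix z :: 'a and \<delta> :: real
    assume "0 < \<delta>"
    \<comment> \<open>Passing from \<open>x m\<close> to \<open>z\<close> costs
      \<open>norm (x m - z)\<close> twice, and the defect of \<open>e m\<close> at
      \<open>x m\<close> costs \<open>\<epsilon> m * norm (x m)\<close>: three errors below
      \<open>\<delta> / 3\<close>. The bound \<open>norm z + 1\<close> for \<open>norm (x m)\<close>
      allows \<open>N\<close> to be fixed before \<open>m\<close>.\<close>
    have "(\<lambda>n. \<epsilon> n * (norm z + 1)) \<longlonglongrightarrow> 0 * (norm z + 1)"
      unfolding \<epsilon>_def by (intro tendsto_mult_right LIMSEQ_Suc LIMSEQ_realpow_zero) auto
    then have "\<forall>\<^sub>F n in sequentially. \<epsilon> n * (norm z + 1) < \<delta> / 3"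
      using \<open>0 < \<delta>\<close> by (intro order_tendstoD) auto
    then obtain N where N: "\<And>m. N \<le> m \<Longrightarrow> \<epsilon> m * (norm z + 1) < \<delta> / 3"
      by (auto simp: eventually_sequentially)
    have "0 < min 1 (\<delta> / 3)"
      using \<open>0 < \<delta>\<close> by simp
    then obtain m where m: "max n N \<le> m" "dist (x m) z < min 1 (\<delta> / 3)"
      using x by blast
    have d: "norm (x m - z) < 1" "norm (x m - z) < \<delta> / 3"
      using m by (auto simp: dist_norm)
    have nx: "norm (x m) \<le> norm z + norm (x m - z)" "norm z \<le> norm (x m) + norm (x m - z)"
      using norm_triangle_sub[of "x m" z] norm_triangle_sub[of z "x m"] by (auto simp: norm_minus_commute)
    have "\<epsilon> m * norm (x m) \<le> \<epsilon> m * (norm z + 1)"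
      using nx d \<epsilon>(1)[of m] by (intro mult_left_mono) auto
    then have "\<epsilon> m * norm (x m) < \<delta> / 3"
      using N[of m] m by linarith
    moreover have "\<bar>blinfun_apply (e m) (x m - z)\<bar> \<le> norm (x m - z)"
      by (rule blinfun_abs_le) (simp add: e)
    then have "blinfun_apply (e m) (x m) \<le> blinfun_apply (e m) z + norm (x m - z)"
      by (simp add: blinfun.diff_right)
    ultimately have "norm z - \<delta> \<le> blinfun_apply (e m) z"
      using e(3)[of m] nx d by (simp add: algebra_simps)
    moreover have "e m \<in> span (e ` {n..})"
      using m by (intro span_base) auto
    ultimately show "\<exists>y\<in>span (e ` {n..}). norm y = 1 \<and> norm z - \<delta> \<le> blinfun_apply y z"
      using e(2) by blast
  qed simp
  then have "double_norming e"
    using e(2) by (simp add: double_norming_def)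
  moreover have "asymptotic_l1_seq e"
    unfolding asymptotic_l1_seq_def
  \<comment> \<open>The definition pairs its \<open>n\<close>-th number with
    \<open>e (Suc n)\<close>, whereas the construction pairs \<open>\<epsilon> n\<close> with
    \<open>e n\<close>; hence the shift.\<close>
  proof (intro conjI exI[of _ "\<lambda>n. \<epsilon> (Suc n)"] allI)
    show "e n \<in> cball 0 1 - {0}" for n
      using e(2)[of n] by auto
    show "eps1_orthogonal (\<epsilon> (Suc n)) (e (Suc n)) (span (e ` {..n}))" for n
      using e(4)[of "Suc n"] by (simp add: lessThan_Suc_atMost)
    show "\<exists>p>0. (\<lambda>n. 1 - \<epsilon> (Suc n)) has_prod p"
      using has_prod_minus_powers_half by (simp only: \<epsilon>_def)
  qed (rule \<epsilon>(1))
  ultimately show ?thesis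
    by blast
qed

section \<open>Tails of asymptotic \<open>\<ell>\<^sub>1\<close>-sequences\<close>

lemma span_image_finite_stage:
  assumes "v \<in> span ((e :: nat \<Rightarrow> 'a::real_vector) ` A)"
  shows "\<exists>m. v \<in> span (e ` (A \<inter> {..<m}))"
proof -
  obtain B c where B: "finite B" "B \<subseteq> e ` A" "v = (\<Sum>a\<in>B. c a *\<^sub>R a)"
    using assms by (auto simp: span_explicit)
  have "v \<in> span B"
    unfolding B(3) by (intro span_sum span_scale span_base)
  obtain I where I: "I \<subseteq> A" "finite I" "B = e ` I"
    using B by (meson finite_subset_image)
  then obtain m where "\<And>i. i \<in> I \<Longrightarrow> i < m"
    by (meson finite_nat_bounded lessThan_iff subsetD)
  with I have "B \<subseteq> e ` (A \<inter> {..<m})"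
    by auto
  then show ?thesis
    using \<open>v \<in> span B\<close> span_mono by blast
qed

text \<open>Induction on \<open>m\<close>: splitting off the last term
  \<open>c *\<^sub>R e (Suc (n + m))\<close> of \<open>w\<close> costs one factor by orthogonality
  to \<open>y + w'\<close>, and the induction hypothesis handles \<open>y + w'\<close>. The earlier
  product is at most 1, so it does not increase \<bar>c\<bar>.\<close>

lemma norm_add_tail_ge:
  fixes e :: "nat \<Rightarrow> 'a::real_normed_vector"
  assumes orth: "\<And>k. n \<le> k \<Longrightarrow> eps1_orthogonal (\<epsilon> k) (e (Suc k)) (span (e ` {..k}))"
    and \<epsilon>: "\<And>k. n \<le> k \<Longrightarrow> 0 < \<epsilon> k" "\<And>k. n \<le> k \<Longrightarrow> \<epsilon> k < 1"
    and y: "y \<in> span (e ` {..n})" and w: "w \<in> span (e ` {Suc n..<Suc n + m})"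
  shows "(\<Prod>k = n..<n + m. 1 - \<epsilon> k) * (norm y + norm w) \<le> norm (y + w)"
  using w
proof (induction m arbitrary: w)
  case 0
  then show ?case
    by simp
next
  case (Suc m)
  let ?p = "\<Prod>k = n..<n + m. 1 - \<epsilon> k"
  have "{Suc n..<Suc n + Suc m} = insert (Suc (n + m)) {Suc n..<Suc n + m}"
    by auto
  then have "w \<in> span (insert (e (Suc (n + m))) (e ` {Suc n..<Suc n + m}))"
    using Suc.prems by (metis image_insert)
  then obtain c where c: "w - c *\<^sub>R e (Suc (n + m)) \<in> span (e ` {Suc n..<Suc n + m})"
    by (auto simp: span_breakdown_eq)
  define w' where "w' = w - c *\<^sub>R e (Suc (n + m))"
  have p: "0 \<le> ?p" "?p \<le> 1"
    using \<epsilon> by (auto intro!: prod_nonneg prod_le_1 simp: less_imp_le)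
  have \<epsilon>m: "0 < 1 - \<epsilon> (n + m)"
    using \<epsilon>(2)[of "n + m"] by simp
  have om: "eps1_orthogonal (\<epsilon> (n + m)) (e (Suc (n + m))) (span (e ` {..n + m}))"
    by (rule orth) simp
  have "y \<in> span (e ` {..n + m})"
    using y span_mono[of "e ` {..n}" "e ` {..n + m}"] by fastforce
  moreover have "w' \<in> span (e ` {..n + m})"
    using c span_mono[of "e ` {Suc n..<Suc n + m}" "e ` {..n + m}"] unfolding w'_def by fastforce
  ultimately have "y + w' \<in> span (e ` {..n + m})"
    by (rule span_add)
  then have "(1 - \<epsilon> (n + m)) * (norm (y + w') + \<bar>c\<bar>) \<le> norm (y + w' + c *\<^sub>R e (Suc (n + m)))"
    using om by (simp only: eps1_orthogonal_def)
  also have "y + w' + c *\<^sub>R e (Suc (n + m)) = y + w"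
    by (simp add: w'_def)
  finally have 1: "(1 - \<epsilon> (n + m)) * (norm (y + w') + \<bar>c\<bar>) \<le> norm (y + w)" .
  have "norm (e (Suc (n + m))) \<le> 1"
    using om by (simp add: eps1_orthogonal_def)
  then have "norm w \<le> norm w' + \<bar>c\<bar>"
    using norm_triangle_ineq[of w' "c *\<^sub>R e (Suc (n + m))"] mult_left_le[of "norm (e (Suc (n + m)))" "\<bar>c\<bar>"]
    by (simp add: w'_def)
  then have "?p * (norm y + norm w) \<le> ?p * (norm y + norm w' + \<bar>c\<bar>)"
    using p by (intro mult_left_mono) auto
  also have "\<dots> = ?p * (norm y + norm w') + ?p * \<bar>c\<bar>"
    by (simp add: algebra_simps)
  also have "\<dots> \<le> norm (y + w') + \<bar>c\<bar>"
    using Suc.IH[of w'] c p by (intro add_mono mult_left_le_one_le) (auto simp: w'_def)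
  finally have "(1 - \<epsilon> (n + m)) * (?p * (norm y + norm w)) \<le> (1 - \<epsilon> (n + m)) * (norm (y + w') + \<bar>c\<bar>)"
    using \<epsilon>m by (intro mult_left_mono) auto
  with 1 show ?case
    by (simp add: mult_ac)
qed

text \<open>By the Cauchy criterion for convergent products, all products over late blocks are close
  to 1, while \<open>y\<close> already lies in the span of finitely many terms.
  \<open>norm_add_tail_ge\<close> then applies with one starting index for all
  \<open>w\<close>.\<close>

lemma asymptotic_l1_tail:
  assumes e: "asymptotic_l1_seq e" and y: "y \<in> span (range e)" and "0 < \<delta>"
  obtains n where "\<And>w. w \<in> span (e ` {n..}) \<Longrightarrow> (1 - \<delta>) * (norm y + norm w) \<le> norm (y + w)"
proof -
  obtain \<epsilon> p where \<epsilon>: "\<And>n. 0 < \<epsilon> n" and p: "(\<lambda>n. 1 - \<epsilon> n) has_prod p"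
    and orth: "\<And>n. eps1_orthogonal (\<epsilon> n) (e (Suc n)) (span (e ` {..n}))"
    using e unfolding asymptotic_l1_seq_def by blast
  \<comment> \<open>The bound 1, applied to one-factor blocks, gives \<open>\<epsilon> k < 1\<close>
    from \<open>n\<close> on; earlier \<open>\<epsilon> k\<close> may exceed 1.\<close>
  define \<eta> where "\<eta> = min 1 \<delta>"
  have "0 < \<eta>"
    using assms(3) by (simp add: \<eta>_def)
  moreover have "convergent_prod (\<lambda>n. 1 - \<epsilon> n)"
    using p by (simp add: has_prod_iff)
  ultimately obtain N where N: "\<And>m n. N \<le> m \<Longrightarrow> m \<le> n \<Longrightarrow> dist (\<Prod>k = m..n. 1 - \<epsilon> k) 1 < \<eta>"
    unfolding convergent_prod_Cauchy_iff by metis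
  obtain l where l: "y \<in> span (e ` {..<l})"
    using span_image_finite_stage[OF y] by auto
  define n where "n = max N l"
  have yn: "y \<in> span (e ` {..n})"
    using l span_mono[of "e ` {..<l}" "e ` {..n}"] by (fastforce simp: n_def)
  have lt: "\<epsilon> k < 1" if "n \<le> k" for k
    using N[of k k] that by (auto simp: n_def \<eta>_def dist_real_def)
  have prod: "1 - \<delta> \<le> (\<Prod>k = n..<n + m. 1 - \<epsilon> k)" for m
  proof (cases m)
    case 0
    then show ?thesis
      using assms(3) by simp
  next
    case (Suc i)
    then have "{n..<n + m} = {n..n + i}"
      by auto
    then show ?thesis
      using N[of n "n + i"] by (auto simp: n_def \<eta>_def dist_real_def)
  qed
  have "(1 - \<delta>) * (norm y + norm w) \<le> norm (y + w)" if w: "w \<in> span (e ` {Suc n..})" for w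
  proof -
    obtain m where "w \<in> span (e ` ({Suc n..} \<inter> {..<m}))"
      using span_image_finite_stage[OF w] by blast
    then have "w \<in> span (e ` {Suc n..<Suc n + m})"
      using span_mono[of "e ` ({Suc n..} \<inter> {..<m})" "e ` {Suc n..<Suc n + m}"] by fastforce
    then have "(\<Prod>k = n..<n + m. 1 - \<epsilon> k) * (norm y + norm w) \<le> norm (y + w)"
      using norm_add_tail_ge[of n \<epsilon> e] orth \<epsilon> lt yn by blast
    moreover have "(1 - \<delta>) * (norm y + norm w) \<le> (\<Prod>k = n..<n + m. 1 - \<epsilon> k) * (norm y + norm w)"
      using prod by (intro mult_right_mono) auto
    ultimately show ?thesis
      by linarith
  qed
  then show ?thesis
    using that by blast
qed

section \<open>From the sequence to the Daugavet equation\<close>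

text \<open>At a vector \<open>z\<close> almost norming \<open>y + f\<close>, the value of
  \<open>f\<close> on the image of \<open>z\<close> under Id + \<open>rank_one y x\<close> is
  \<open>f z + y z * f x\<close>. It falls short of \<open>(y + f) z\<close> by
  \<open>y z * (1 - f x)\<close>, at most \<open>\<delta> * norm y\<close>.\<close>

lemma norm_id_add_rank_one_ge:
  fixes f y :: "'a::real_normed_vector \<Rightarrow>\<^sub>L real"
  assumes "norm f \<le> 1" "norm x = 1" "1 - \<delta> \<le> blinfun_apply f x"
  shows "norm (y + f) - \<delta> * norm y \<le> norm (id_blinfun + rank_one y x)"
proof (rule field_le_epsilon)
  fix \<eta> :: real
  assume "0 < \<eta>"
  then have "norm (y + f) - \<eta> < norm (y + f)"
    by simp
  then obtain z where z: "norm z \<le> 1" "norm (y + f) - \<eta> < blinfun_apply (y + f) z"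
    by (rule blinfun_real_norm_approx)
  have yz: "\<bar>blinfun_apply y z\<bar> \<le> norm y"
    using norm_blinfun[of y z] mult_left_mono[OF z(1) norm_ge_zero[of y]] by simp
  have fx: "0 \<le> 1 - blinfun_apply f x" "1 - blinfun_apply f x \<le> \<delta>"
    using blinfun_abs_le[OF assms(1), of x] assms by auto
  have "blinfun_apply y z * (1 - blinfun_apply f x) \<le> norm y * (1 - blinfun_apply f x)"
    using yz fx by (intro mult_right_mono) auto
  also have "\<dots> \<le> norm y * \<delta>"
    using fx by (intro mult_left_mono) auto
  finally have "blinfun_apply (y + f) z - \<delta> * norm y \<le> blinfun_apply f (z + blinfun_apply y z *\<^sub>R x)"
    by (simp add: blinfun.add_left blinfun.add_right blinfun.scaleR_right algebra_simps)
  also have "\<dots> \<le> norm (z + blinfun_apply y z *\<^sub>R x)"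
    using blinfun_abs_le[OF assms(1), of "z + blinfun_apply y z *\<^sub>R x"] by simp
  also have "\<dots> \<le> norm (id_blinfun + rank_one y x)"
    using norm_blinfun[of "id_blinfun + rank_one y x" z]
      mult_left_mono[OF z(1) norm_ge_zero[of "id_blinfun + rank_one y x"]]
    by (simp add: blinfun.add_left)
  finally show "norm (y + f) - \<delta> * norm y \<le> norm (id_blinfun + rank_one y x) + \<eta>"
    using z(2) by simp
qed

text \<open>Moving the factor \<open>norm x\<close> into the functional reduces the lower estimate
  to unit vectors. For \<open>x = 0\<close> the functional becomes zero and the normalised
  \<open>x0\<close> serves as the unit vector.\<close>

lemma Daugavet_propertyI:
  assumes "subspace Y" and "x0 \<noteq> (0::'a::real_normed_vector)"
    and ge: "\<And>y x::'a. y \<in> Y \<Longrightarrow> norm x = 1 \<Longrightarrow> 1 + norm y \<le> norm (id_blinfun + rank_one y x)"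
  shows "Daugavet_property Y"
  unfolding Daugavet_property_def
proof (intro allI ballI antisym)
  fix x :: 'a and y
  assume y: "y \<in> Y"
  have id: "norm (id_blinfun :: 'a \<Rightarrow>\<^sub>L 'a) \<le> 1"
    by (rule norm_blinfun_bound) auto
  show "norm (id_blinfun + rank_one y x) \<le> 1 + norm (rank_one y x)"
    using norm_triangle_ineq[of id_blinfun "rank_one y x"] id by linarith
  define u where "u = (if x = 0 then x0 else x)"
  have u: "u \<noteq> 0"
    using assms(2) by (simp add: u_def)
  have "norm x *\<^sub>R y \<in> Y"
    using y assms(1) by (simp add: subspace_scale)
  moreover have "norm (u /\<^sub>R norm u) = 1"
    using u by simp
  ultimately have "1 + norm (norm x *\<^sub>R y) \<le> norm (id_blinfun + rank_one (norm x *\<^sub>R y) (u /\<^sub>R norm u))"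
    by (rule ge)
  moreover have "rank_one (norm x *\<^sub>R y) (u /\<^sub>R norm u) = rank_one y x"
    by (rule blinfun_eqI) (auto simp: u_def blinfun.scaleR_left)
  ultimately show "1 + norm (rank_one y x) \<le> norm (id_blinfun + rank_one y x)"
    by (simp add: mult_ac)
qed

lemma sequence_imp_almost_Daugavet:
  fixes e :: "nat \<Rightarrow> 'a::banach \<Rightarrow>\<^sub>L real"
  assumes dn: "double_norming e" and l1: "asymptotic_l1_seq e"
  shows "almost_Daugavet TYPE('a)"
proof -
  have norming: "norming (span (e ` {n..}))" for n
    using dn by (simp add: double_norming_def)
  have "e 0 \<noteq> 0"
    using l1 by (auto simp: asymptotic_l1_seq_def)
  then obtain x0 where "blinfun_apply (e 0) x0 \<noteq> 0"
    by (metis blinfun_eqI zero_blinfun.rep_eq)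
  then have x0: "x0 \<noteq> 0"
    by auto
  have "Daugavet_property (span (range e))"
  proof (rule Daugavet_propertyI[OF subspace_span x0])
    fix y x
    assume y: "y \<in> span (range e)" and x: "norm (x::'a) = 1"
    show "1 + norm y \<le> norm (id_blinfun + rank_one y x)"
    proof (rule field_le_epsilon)
      fix \<eta> :: real
      assume \<eta>: "0 < \<eta>"
      \<comment> \<open>Orthogonality of \<open>f\<close> loses
        \<open>\<delta> * (norm y + 1)\<close> and \<open>norm_id_add_rank_one_ge\<close> loses
        \<open>\<delta> * norm y\<close>; together this is \<open>\<eta>\<close>.\<close>
      define \<delta> where "\<delta> = \<eta> / (1 + 2 * norm y)"
      have pos: "0 < 1 + 2 * norm y"
        using norm_ge_zero[of y] by linarith
      then have \<delta>: "0 < \<delta>" "\<delta> * (1 + 2 * norm y) = \<eta>"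
        using \<eta> by (auto simp: \<delta>_def)
      obtain n where n: "\<And>w. w \<in> span (e ` {n..}) \<Longrightarrow> (1 - \<delta>) * (norm y + norm w) \<le> norm (y + w)"
        using asymptotic_l1_tail[OF l1 y \<delta>(1)] by blast
      obtain f where f: "f \<in> span (e ` {n..})" "norm f = 1" "norm x - \<delta> < blinfun_apply f x"
        using norming_approx[OF norming x0 \<delta>(1)] by blast
      have "norm (y + f) - \<delta> * norm y \<le> norm (id_blinfun + rank_one y x)"
        using f x by (intro norm_id_add_rank_one_ge) auto
      moreover have "(1 - \<delta>) * (norm y + 1) \<le> norm (y + f)"
        using n[OF f(1)] f(2) by simp
      ultimately show "1 + norm y \<le> norm (id_blinfun + rank_one y x) + \<eta>"
        using \<delta>(2) by (simp add: algebra_simps)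
    qed
  qed
  moreover have "norming (span (range e))"
    using norming[of 0] by simp
  ultimately show ?thesis
    by (auto simp: almost_Daugavet_def)
qed

theorem theorem2p5:
  assumes "separable_space (euclidean :: 'a::banach topology)"
  shows "almost_Daugavet TYPE('a) \<longleftrightarrow>
    (\<exists>e :: nat \<Rightarrow> 'a \<Rightarrow>\<^sub>L real. double_norming e \<and> asymptotic_l1_seq e)"
  using almost_Daugavet_imp_sequence[OF assms] sequence_imp_almost_Daugavet by blast

end
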